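(* The matrix $\check{\mathbf V}$ is invertible and $$\check{\mathbf V}^{-1}=\frac{m_U}{\lambda_0}\bar{\mathbf I}_{\mathbf m}+m_U\Bigl[\sum_{(i_1,i_2)\in\{0,1\}^2}\delta_{i_2i_1}\bigl(\tilde{\mathbf J}_g^{\,i_1}\otimes\tilde{\mathbf J}_h^{\,i_2}\bigr)\Bigr]_{\mathrm{cell}}\circledast\bar{\mathbf J}_{\mathbf m},$$ where $\tilde{\mathbf J}_a^{\,0}=\mathbf I_a$, $\tilde{\mathbf J}_a^{\,1}=\tilde{\mathbf J}_a$, and $$\delta_{00}=\frac1{\lambda_7}-\frac1{\lambda_0},\quad \delta_{01}=\frac1{\lambda_5}-\frac1{\lambda_7},\quad \delta_{10}=\frac1{\lambda_3}-\frac1{\lambda_7},\quad \delta_{11}=\frac1{\lambda_1}-\frac1{\lambda_3}-\frac1{\lambda_5}+\frac1{\lambda_7}.$$ (Explicitly, $\delta_{01}$ multiplies $\tilde{\mathbf J}_g\otimes\mathbf I_h$ and $\delta_{10}$ multiplies $\mathbf I_g\otimes\tilde{\mathbf J}_h$.)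
   Context: Setting. $g,h\ge 1$ are integers, $m_{ij}\ge 1$ ($1\le i\le g$, $1\le j\le h$) are integers (cell sizes), $n=\sum_{i,j}m_{ij}$, $m_U=\max_{i,j}m_{ij}$. The $n$ observations are indexed by triples $(i,j,k)$, $1\le k\le m_{ij}$, in lexicographic order; thus $n\times n$ matrices are partitioned into $gh\times gh$ blocks indexed by pairs of cells, cells in lexicographic order. The variance components satisfy $\sigma_e^2>0$ and $\sigma_\alpha^2,\sigma_\beta^2,\sigma_\gamma^2\ge 0$. Khatri–Rao product. For partitioned matrices with the same numbers of row and column partitions, $\mathbf A\circledast\mathbf B=(\mathbf A_{ab}\otimes\mathbf B_{ab})_{ab}$. The subscript $(\cdot)_{\mathrm{cell}}$ means every scalar entry is treated as a block; so for a $gh\times gh$ matrix $\mathbf A$ and an $n\times n$ block matrix $\mathbf B$, $\mathbf A_{\mathrm{cell}}\circledast\mathbf B$ multiplies each block of $\mathbf B$ by the corresponding entry of $\mathbf A$. Notation. $\mathbf J_a$ is the $a\times a$ all-ones matrix, $\mathbf I_a$ the identity, $\tilde{\mathbf J}_a=\frac1a\mathbf J_a$; $\mathbf J_{\mathbf m}$ is the $n\times n$ all-ones matrix; $\mathbf I_{\mathbf m}^M=\operatorname{diag}(m_{11}\mathbf I_{m_{11}},\dots,m_{gh}\mathbf I_{m_{gh}})$; $\bar{\mathbf I}_{\mathbf m}=\operatorname{diag}(m_{11}^{-1}\mathbf I_{m_{11}},\dots,m_{gh}^{-1}\mathbf I_{m_{gh}})$; $\bar{\mathbf J}_{\mathbf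 m}=\bar{\mathbf I}_{\mathbf m}\mathbf J_{\mathbf m}\bar{\mathbf I}_{\mathbf m}$ (its block at cells $(i,j),(i',j')$ is $\frac1{m_{ij}m_{i'j'}}$ times the $m_{ij}\times m_{i'j'}$ all-ones matrix). Modified covariance matrix: $\check{\mathbf V}=\frac{\sigma_e^2}{m_U}\mathbf I_{\mathbf m}^M+\mathbf D$, with $\mathbf D=\sigma_\alpha^2(\mathbf I_g\otimes\mathbf J_h)_{\mathrm{cell}}\circledast\mathbf J_{\mathbf m}+\sigma_\beta^2(\mathbf J_g\otimes\mathbf I_h)_{\mathrm{cell}}\circledast\mathbf J_{\mathbf m}+\sigma_\gamma^2(\mathbf I_g\otimes\mathbf I_h)_{\mathrm{cell}}\circledast\mathbf J_{\mathbf m}.$ $\lambda_0=\sigma_e^2$, $\lambda_1=\sigma_e^2+m_U\sigma_\gamma^2+hm_U\sigma_\alpha^2+gm_U\sigma_\beta^2$, $\lambda_3=\sigma_e^2+m_U\sigma_\gamma^2+hm_U\sigma_\alpha^2$, $\lambda_5=\sigma_e^2+m_U\sigma_\gamma^2+gm_U\sigma_\beta^2$, $\lambda_7=\sigma_e^2+m_U\sigma_\gamma^2$. *)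

theory Defs
  imports Complex_Main "Jordan_Normal_Form.Matrix"
begin

definition kronecker :: "'a :: times mat \<Rightarrow> 'a mat \<Rightarrow> 'a mat" (infixl \<open>\<otimes>\<^sub>K\<close> 70) where
  "A \<otimes>\<^sub>K B = mat (dim_row A * dim_row B) (dim_col A * dim_col B)
     (\<lambda>(p, q). A $$ (p div dim_row B, q div dim_col B) * B $$ (p mod dim_row B, q mod dim_col B))"

(* A partition of the index set {0..<sum_list ss} into consecutive segments is given by the
   list ss of the segment sizes.  Segments and positions inside a segment are counted from 0. *)

definition seg_start :: "nat list \<Rightarrow> nat \<Rightarrow> nat" where
  "seg_start ss a = sum_list (take a ss)"

definition seg_of :: "nat list \<Rightarrow> nat \<Rightarrow> nat" where
  "seg_of ss p = (LEAST a. p < seg_start ss (Suc a))"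

definition seg_pos :: "nat list \<Rightarrow> nat \<Rightarrow> nat" where
  "seg_pos ss p = p - seg_start ss (seg_of ss p)"

(* A partitioned matrix is a triple: row segment sizes, column segment sizes, matrix. *)

type_synonym 'a pmat = "nat list \<times> nat list \<times> 'a mat"

fun pblock :: "'a pmat \<Rightarrow> nat \<Rightarrow> nat \<Rightarrow> 'a mat" where
  "pblock (rs, cs, A) a b =
     mat (rs ! a) (cs ! b) (\<lambda>(p, q). A $$ (seg_start rs a + p, seg_start cs b + q))"

definition assemble :: "nat list \<Rightarrow> nat list \<Rightarrow> (nat \<Rightarrow> nat \<Rightarrow> 'a mat) \<Rightarrow> 'a mat" where
  "assemble rs cs F = mat (sum_list rs) (sum_list cs)
     (\<lambda>(p, q). F (seg_of rs p) (seg_of cs q) $$ (seg_pos rs p, seg_pos cs q))"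

(* Meaningful if both arguments have the same numbers of row and of column segments. *)

fun khatri_rao :: "'a :: times pmat \<Rightarrow> 'a pmat \<Rightarrow> 'a mat" (infixl \<open>\<circledast>\<close> 70) where
  "(rs, cs, A) \<circledast> (rs', cs', B) = assemble (map2 (*) rs rs') (map2 (*) cs cs')
     (\<lambda>a b. pblock (rs, cs, A) a b \<otimes>\<^sub>K pblock (rs', cs', B) a b)"

definition cellwise :: "'a mat \<Rightarrow> 'a pmat" where
  "cellwise A = (replicate (dim_row A) 1, replicate (dim_col A) 1, A)"

definition ones_mat :: "nat \<Rightarrow> real mat" where
  "ones_mat a = mat a a (\<lambda>_. 1)"

definition avg_mat :: "nat \<Rightarrow> real mat" where
  "avg_mat a = (1 / real a) \<cdot>\<^sub>m ones_mat a"

(* m i j is the size of cell (i, j) for 1 <= i <= g and 1 <= j <= h; its other values are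
   irrelevant.  The cells are listed in lexicographic order. *)

definition cell_sizes :: "nat \<Rightarrow> nat \<Rightarrow> (nat \<Rightarrow> nat \<Rightarrow> nat) \<Rightarrow> nat list" where
  "cell_sizes g h m = concat (map (\<lambda>i. map (\<lambda>j. m i j) [1..<Suc h]) [1..<Suc g])"

definition max_cell :: "nat \<Rightarrow> nat \<Rightarrow> (nat \<Rightarrow> nat \<Rightarrow> nat) \<Rightarrow> nat" where
  "max_cell g h m = Max {m i j | i j. i \<in> {1..g} \<and> j \<in> {1..h}}"

definition num_obs :: "nat \<Rightarrow> nat \<Rightarrow> (nat \<Rightarrow> nat \<Rightarrow> nat) \<Rightarrow> nat" where
  "num_obs g h m = (\<Sum>i = 1..g. \<Sum>j = 1..h. m i j)"

definition by_cells :: "nat \<Rightarrow> nat \<Rightarrow> (nat \<Rightarrow> nat \<Rightarrow> nat) \<Rightarrow> 'a mat \<Rightarrow> 'a pmat" where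
  "by_cells g h m B = (cell_sizes g h m, cell_sizes g h m, B)"

definition J_m :: "nat \<Rightarrow> nat \<Rightarrow> (nat \<Rightarrow> nat \<Rightarrow> nat) \<Rightarrow> real mat" where
  "J_m g h m = ones_mat (num_obs g h m)"

definition I_m_M :: "nat \<Rightarrow> nat \<Rightarrow> (nat \<Rightarrow> nat \<Rightarrow> nat) \<Rightarrow> real mat" where
  "I_m_M g h m = diag_block_mat (map (\<lambda>s. real s \<cdot>\<^sub>m 1\<^sub>m s) (cell_sizes g h m))"

definition I_m_bar :: "nat \<Rightarrow> nat \<Rightarrow> (nat \<Rightarrow> nat \<Rightarrow> nat) \<Rightarrow> real mat" where
  "I_m_bar g h m = diag_block_mat (map (\<lambda>s. inverse (real s) \<cdot>\<^sub>m 1\<^sub>m s) (cell_sizes g h m))"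

definition J_m_bar :: "nat \<Rightarrow> nat \<Rightarrow> (nat \<Rightarrow> nat \<Rightarrow> nat) \<Rightarrow> real mat" where
  "J_m_bar g h m = I_m_bar g h m * J_m g h m * I_m_bar g h m"

(* The arguments ve, va, vb, vc below are the variance components
   sigma_e^2, sigma_alpha^2, sigma_beta^2, sigma_gamma^2 themselves, not their square roots. *)

definition D_mat ::
  "nat \<Rightarrow> nat \<Rightarrow> (nat \<Rightarrow> nat \<Rightarrow> nat) \<Rightarrow> real \<Rightarrow> real \<Rightarrow> real \<Rightarrow> real mat" where
  "D_mat g h m va vb vc =
     va \<cdot>\<^sub>m (cellwise (1\<^sub>m g \<otimes>\<^sub>K ones_mat h) \<circledast> by_cells g h m (J_m g h m))
   + vb \<cdot>\<^sub>m (cellwise (ones_mat g \<otimes>\<^sub>K 1\<^sub>m h) \<circledast> by_cells g h m (J_m g h m))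
   + vc \<cdot>\<^sub>m (cellwise (1\<^sub>m g \<otimes>\<^sub>K 1\<^sub>m h) \<circledast> by_cells g h m (J_m g h m))"

definition V_check ::
  "nat \<Rightarrow> nat \<Rightarrow> (nat \<Rightarrow> nat \<Rightarrow> nat) \<Rightarrow> real \<Rightarrow> real \<Rightarrow> real \<Rightarrow> real \<Rightarrow> real mat" where
  "V_check g h m ve va vb vc =
     (ve / real (max_cell g h m)) \<cdot>\<^sub>m I_m_M g h m + D_mat g h m va vb vc"

end

(* Write c(p) for the cell of observation p and w_c for the size of cell c.  With X and Y the
   gh x gh coefficient matrices of the Khatri-Rao parts of V and W, and s = ve, M = mU, one has
     V(p,q) = (s/M) w_c(p) [p = q] + X(c(p), c(q)),
     W(p,q) = M / (s w_c(p)) [p = q] + M Y(c(p), c(q)) / (w_c(p) w_c(q)).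
   In V W the sum over the observations of a cell contributes a factor w_c, which cancels the
   weights in W, so V W = 1 reduces to s Y + (M/s) X + M X Y = 0, in which the cell sizes no longer
   occur.  X and Y lie in the algebra spanned by I (x) I, J (x) I, I (x) J, J (x) J, so this is an
   identity between four coefficients. *)

theory Submission
  imports Defs "Jordan_Normal_Form.Determinant"
begin

section \<open>Segments of a partitioned index set\<close>

lemma seg_start_Suc:
  "a < length ss \<Longrightarrow> seg_start ss (Suc a) = seg_start ss a + ss ! a"
  by (simp add: seg_start_def take_Suc_conv_app_nth)

lemma seg_start_mono: "a \<le> b \<Longrightarrow> seg_start ss a \<le> seg_start ss b"
proof -
  assume "a \<le> b"
  then have "take b ss = take a ss @ take (b - a) (drop a ss)"
    by (metis le_add_diff_inverse take_add)
  then show ?thesis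
    by (simp add: seg_start_def)
qed

lemma seg_start_length: "seg_start ss (length ss) = sum_list ss"
  by (simp add: seg_start_def)

lemma seg_of_eqI:
  assumes "seg_start ss a \<le> p" and "p < seg_start ss (Suc a)"
  shows "seg_of ss p = a"
  unfolding seg_of_def
proof (rule Least_equality)
  fix b assume b: "p < seg_start ss (Suc b)"
  show "a \<le> b"
  proof (rule ccontr)
    assume "\<not> a \<le> b"
    then have "seg_start ss (Suc b) \<le> seg_start ss a"
      by (intro seg_start_mono) simp
    with assms b show False by simp
  qed
qed (fact assms(2))

text \<open>The upper bound is the defining property of the least index, and the lower bound is its
  minimality. The index stays below \<open>length ss\<close> because past the end
  \<open>seg_start\<close> is constantly \<open>sum_list ss\<close>.\<close>

lemma seg_of_bounds:
  assumes "p < sum_list ss"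
  shows "seg_of ss p < length ss"
    and "seg_start ss (seg_of ss p) \<le> p"
    and "p < seg_start ss (Suc (seg_of ss p))"
proof -
  have "\<exists>a. seg_of ss p = a \<and> a < length ss \<and> seg_start ss a \<le> p \<and> p < seg_start ss (Suc a)"
  proof -
    \<comment> \<open>Taking more elements than the list has returns the whole list, so
      \<open>length ss\<close> always satisfies the condition under LEAST.\<close>
    have ex: "p < seg_start ss (Suc (length ss))"
      using assms by (simp add: seg_start_def)
    define a where "a = (LEAST a. p < seg_start ss (Suc a))"
    have up: "p < seg_start ss (Suc a)"
      unfolding a_def using ex by (rule LeastI)
    have low: "seg_start ss a \<le> p"
    proof (cases a)
      case 0
      then show ?thesis by (simp add: seg_start_def)
    next
      case (Suc b)
      then have "\<not> p < seg_start ss (Suc b)"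
        using not_less_Least[of b "\<lambda>a. p < seg_start ss (Suc a)"] by (simp add: a_def)
      with Suc show ?thesis by simp
    qed
    have "a < length ss"
    proof (rule ccontr)
      assume "\<not> a < length ss"
      then have "seg_start ss a = sum_list ss" by (simp add: seg_start_def)
      with low assms show False by simp
    qed
    with up low show ?thesis by (auto simp: seg_of_def a_def)
  qed
  then show "seg_of ss p < length ss" "seg_start ss (seg_of ss p) \<le> p"
    "p < seg_start ss (Suc (seg_of ss p))" by auto
qed

lemma seg_start_add_pos: "p < sum_list ss \<Longrightarrow> seg_start ss (seg_of ss p) + seg_pos ss p = p"
  using seg_of_bounds(2)[of p ss] by (simp add: seg_pos_def)

lemma seg_pos_less: "p < sum_list ss \<Longrightarrow> seg_pos ss p < ss ! seg_of ss p"
  using seg_of_bounds[of p ss] by (simp add: seg_pos_def seg_start_Suc)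

text \<open>The indices with \<open>seg_of ss p = c\<close> form an interval with
  \<open>ss ! c\<close> elements, on which the summand is constant. This is where the weight of a
  cell enters a sum over observations.\<close>

lemma sum_seg_of:
  fixes f :: "nat \<Rightarrow> 'a :: comm_semiring_1"
  shows "(\<Sum>p = 0..<sum_list ss. f (seg_of ss p)) = (\<Sum>c = 0..<length ss. of_nat (ss ! c) * f c)"
proof -
  have "(\<Sum>p = 0..<sum_list ss. f (seg_of ss p)) =
      (\<Sum>c = 0..<length ss. \<Sum>p | p \<in> {0..<sum_list ss} \<and> seg_of ss p = c. f (seg_of ss p))"
    by (rule sum.group[symmetric]) (auto simp: seg_of_bounds)
  also have "\<dots> = (\<Sum>c = 0..<length ss. of_nat (ss ! c) * f c)"
  proof (rule sum.cong[OF refl])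
    fix c assume "c \<in> {0..<length ss}"
    then have c: "c < length ss" by simp
    have "seg_start ss (Suc c) \<le> sum_list ss"
      using seg_start_mono[of "Suc c" "length ss" ss] c by (simp add: seg_start_length)
    then have "{p \<in> {0..<sum_list ss}. seg_of ss p = c} = {seg_start ss c..<seg_start ss (Suc c)}"
      using seg_of_bounds[of _ ss] by (auto intro: seg_of_eqI)
    then have "card {p \<in> {0..<sum_list ss}. seg_of ss p = c} = ss ! c"
      using c by (simp add: seg_start_Suc)
    moreover have "(\<Sum>p | p \<in> {0..<sum_list ss} \<and> seg_of ss p = c. f (seg_of ss p)) =
        (\<Sum>p | p \<in> {0..<sum_list ss} \<and> seg_of ss p = c. f c)"
      by (rule sum.cong) auto
    ultimately show "(\<Sum>p | p \<in> {0..<sum_list ss} \<and> seg_of ss p = c. f (seg_of ss p)) =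
        of_nat (ss ! c) * f c"
      by simp
  qed
  finally show ?thesis .
qed

section \<open>Entries of block diagonal matrices and of cellwise Khatri-Rao products\<close>

lemma seg_of_Cons_less: "p < s \<Longrightarrow> seg_of (s # ss) p = 0"
  by (rule seg_of_eqI) (simp_all add: seg_start_def)

lemma seg_of_Cons_ge:
  assumes "s \<le> p" and "p - s < sum_list ss"
  shows "seg_of (s # ss) p = Suc (seg_of ss (p - s))"
  using seg_of_bounds(2,3)[OF assms(2)] assms(1)
  by (intro seg_of_eqI) (auto simp: seg_start_def)

text \<open>Scalar blocks on the diagonal make the whole matrix diagonal. The induction peels off
  the first block; the remaining indices have their segment number shifted by one.\<close>

lemma diag_block_mat_scalar_blocks:
  fixes f :: "nat \<Rightarrow> 'a :: semiring_1"
  shows "diag_block_mat (map (\<lambda>s. f s \<cdot>\<^sub>m 1\<^sub>m s) ss) =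
    mat (sum_list ss) (sum_list ss) (\<lambda>(p, q). if p = q then f (ss ! seg_of ss p) else 0)"
proof (induction ss)
  case Nil
  show ?case by (intro eq_matI) auto
next
  case (Cons s ss)
  show ?case
    by (rule eq_matI)
      (auto simp: Let_def Cons.IH four_block_mat_def seg_of_Cons_less seg_of_Cons_ge not_less)
qed

text \<open>Every block of \<open>cellwise A\<close> is 1 x 1, so its Kronecker product with a block
  of \<open>B\<close> is a scalar multiple of that block. Adding the position inside a segment to
  the start of the segment recovers the original index of \<open>B\<close>.\<close>

lemma cellwise_khatri_rao:
  fixes A B :: "'a :: times mat"
  assumes "dim_row A = length ss" and "dim_col A = length ss"
  shows "cellwise A \<circledast> (ss, ss, B) =
    mat (sum_list ss) (sum_list ss) (\<lambda>(p, q). A $$ (seg_of ss p, seg_of ss q) * B $$ (p, q))"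
proof -
  have ones: "map2 (*) (replicate (length ss) (Suc 0)) ss = ss"
    by (rule nth_equalityI) auto
  have start: "seg_start (replicate k (Suc 0)) a = a" if "a \<le> k" for a k
    using that by (simp add: seg_start_def sum_list_replicate)
  show ?thesis
    by (rule eq_matI)
      (simp_all add: cellwise_def assms assemble_def ones kronecker_def start seg_of_bounds
        seg_pos_less seg_start_add_pos less_imp_le)
qed

lemma sum_nat_div_mod:
  fixes f :: "nat \<Rightarrow> nat \<Rightarrow> 'a :: comm_monoid_add"
  shows "(\<Sum>c = 0..<g * h. f (c div h) (c mod h)) = (\<Sum>i = 0..<g. \<Sum>j = 0..<h. f i j)"
proof (cases "h = 0")
  case False
  have bound: "i * h + j < g * h" if "i < g" "j < h" for i j
  proof -
    have "i * h + j < Suc i * h" using that by simp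
    also have "\<dots> \<le> g * h" using that by (intro mult_right_mono) simp_all
    finally show ?thesis .
  qed
  have "(\<Sum>i = 0..<g. \<Sum>j = 0..<h. f i j) = (\<Sum>(i, j) \<in> {0..<g} \<times> {0..<h}. f i j)"
    by (simp add: sum.cartesian_product)
  also have "\<dots> = (\<Sum>c = 0..<g * h. f (c div h) (c mod h))"
    using False
    by (intro sum.reindex_bij_witness[of _ "\<lambda>c. (c div h, c mod h)" "\<lambda>(i, j). i * h + j"])
      (auto simp: less_mult_imp_div_less bound)
  finally show ?thesis by simp
qed simp

section \<open>Cell sizes, their maximum, and the matrix \<open>J_m_bar\<close>\<close>

lemma length_cell_sizes: "length (cell_sizes g h m) = g * h"
  by (simp add: cell_sizes_def length_concat comp_def sum_list_triv)

lemma sum_list_cell_sizes: "sum_list (cell_sizes g h m) = num_obs g h m"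
proof -
  have iv: "{1..<Suc k} = {1..k}" for k by auto
  have concat: "sum_list (concat xss) = (\<Sum>xs\<leftarrow>xss. sum_list xs)" for xss :: "nat list list"
    by (induction xss) simp_all
  show ?thesis
    by (simp add: cell_sizes_def num_obs_def concat comp_def
        sum_list_distinct_conv_sum_set iv del: upt_Suc One_nat_def)
qed

lemma cell_sizes_pos:
  assumes "\<And>i j. i \<in> {1..g} \<Longrightarrow> j \<in> {1..h} \<Longrightarrow> m i j \<ge> 1" and "s \<in> set (cell_sizes g h m)"
  shows "s > 0"
proof -
  obtain i j where "i \<in> {1..g}" "j \<in> {1..h}" "s = m i j"
    using assms(2) by (force simp: cell_sizes_def simp del: upt_Suc)
  with assms(1)[of i j] show ?thesis by simp
qed

lemma max_cell_pos:
  assumes "g \<ge> 1" and "h \<ge> 1"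
    and "\<And>i j. i \<in> {1..g} \<Longrightarrow> j \<in> {1..h} \<Longrightarrow> m i j \<ge> 1"
  shows "max_cell g h m > 0"
proof -
  have "{m i j | i j. i \<in> {1..g} \<and> j \<in> {1..h}} = (\<lambda>(i, j). m i j) ` ({1..g} \<times> {1..h})"
    by fast
  then have "finite {m i j | i j. i \<in> {1..g} \<and> j \<in> {1..h}}"
    by simp
  moreover have "m 1 1 \<in> {m i j | i j. i \<in> {1..g} \<and> j \<in> {1..h}}"
    using assms(1,2) by force
  ultimately have "m 1 1 \<le> max_cell g h m"
    unfolding max_cell_def by (rule Max_ge)
  with assms(3)[of 1 1] assms(1,2) show ?thesis by simp
qed

text \<open>Both outer factors are diagonal, so each inner sum has a single nonzero term: the left
  factor scales row \<open>p\<close>, the right one column \<open>q\<close>.\<close>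

lemma J_m_bar_eq:
  fixes g h m
  defines "ss \<equiv> cell_sizes g h m"
  shows "J_m_bar g h m = mat (sum_list ss) (sum_list ss)
    (\<lambda>(p, q). inverse (real (ss ! seg_of ss p)) * inverse (real (ss ! seg_of ss q)))"
  by (rule eq_matI)
    (simp_all add: J_m_bar_def I_m_bar_def J_m_def ones_mat_def diag_block_mat_scalar_blocks
      ss_def sum_list_cell_sizes scalar_prod_def if_distrib[of "\<lambda>x. x * _"]
      if_distrib[of "\<lambda>x. _ * x"] cong: if_cong)

section \<open>The algebra spanned by the four Kronecker products of I and J\<close>

text \<open>The coefficients \<open>a, b, c, d\<close> belong to \<open>I \<otimes> I\<close>, \<open>J \<otimes> I\<close>, \<open>I \<otimes> J\<close> and \<open>J \<otimes> J\<close>, in this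
  order.\<close>

definition two_way_mat :: "nat \<Rightarrow> nat \<Rightarrow> real \<Rightarrow> real \<Rightarrow> real \<Rightarrow> real \<Rightarrow> real mat" where
  "two_way_mat g h a b c d = mat (g * h) (g * h) (\<lambda>(p, q).
     a * (of_bool (p div h = q div h) * of_bool (p mod h = q mod h))
     + b * of_bool (p mod h = q mod h) + c * of_bool (p div h = q div h) + d)"

lemma two_way_mat_carrier [simp]: "two_way_mat g h a b c d \<in> carrier_mat (g * h) (g * h)"
  by (simp add: two_way_mat_def)

lemma two_way_mat_add:
  "two_way_mat g h a b c d + two_way_mat g h a' b' c' d' =
    two_way_mat g h (a + a') (b + b') (c + c') (d + d')"
  by (rule eq_matI) (simp_all add: two_way_mat_def algebra_simps)

lemma two_way_mat_smult:
  "k \<cdot>\<^sub>m two_way_mat g h a b c d = two_way_mat g h (k * a) (k * b) (k * c) (k * d)"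
  by (rule eq_matI) (simp_all add: two_way_mat_def algebra_simps)

lemma two_way_mat_zero: "two_way_mat g h 0 0 0 0 = 0\<^sub>m (g * h) (g * h)"
  by (rule eq_matI) (simp_all add: two_way_mat_def)

lemma div_mod_less_of_less_mult:
  fixes p :: nat
  assumes "p < g * h"
  shows "p div h < g" and "p mod h < h"
  using assms by (cases "h = 0"; simp add: less_mult_imp_div_less)+

lemma one_kronecker_one: "1\<^sub>m g \<otimes>\<^sub>K 1\<^sub>m h = two_way_mat g h 1 0 0 0"
  by (rule eq_matI) (auto simp: kronecker_def two_way_mat_def div_mod_less_of_less_mult)

lemma ones_kronecker_one: "ones_mat g \<otimes>\<^sub>K 1\<^sub>m h = two_way_mat g h 0 1 0 0"
  by (rule eq_matI)
    (auto simp: kronecker_def two_way_mat_def ones_mat_def div_mod_less_of_less_mult)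

lemma one_kronecker_ones: "1\<^sub>m g \<otimes>\<^sub>K ones_mat h = two_way_mat g h 0 0 1 0"
  by (rule eq_matI)
    (auto simp: kronecker_def two_way_mat_def ones_mat_def div_mod_less_of_less_mult)

lemma avg_kronecker_one: "avg_mat g \<otimes>\<^sub>K 1\<^sub>m h = two_way_mat g h 0 (1 / g) 0 0"
  by (rule eq_matI)
    (auto simp: kronecker_def two_way_mat_def avg_mat_def ones_mat_def div_mod_less_of_less_mult)

lemma one_kronecker_avg: "1\<^sub>m g \<otimes>\<^sub>K avg_mat h = two_way_mat g h 0 0 (1 / h) 0"
  by (rule eq_matI)
    (auto simp: kronecker_def two_way_mat_def avg_mat_def ones_mat_def div_mod_less_of_less_mult)

lemma avg_kronecker_avg: "avg_mat g \<otimes>\<^sub>K avg_mat h = two_way_mat g h 0 0 0 (1 / (g * h))"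
  by (rule eq_matI)
    (auto simp: kronecker_def two_way_mat_def avg_mat_def ones_mat_def div_mod_less_of_less_mult)

text \<open>The one-factor product (a I + b J)(c I + d J) = a c I + (a d + b c + n b d) J read
  entrywise, where n b d comes from J J = n J.\<close>

lemma sum_affine_of_bool:
  fixes a b c d :: real and n :: nat
  assumes "p < n" and "q < n"
  shows "(\<Sum>i = 0..<n. (a * of_bool (p = i) + b) * (c * of_bool (i = q) + d)) =
    a * c * of_bool (p = q) + a * d + b * c + n * (b * d)"
proof -
  have "(\<Sum>i = 0..<n. (a * of_bool (p = i) + b) * (c * of_bool (i = q) + d)) =
      (\<Sum>i = 0..<n. (if i = p then a * c * of_bool (p = q) + a * d else 0)
        + (if i = q then b * c else 0) + b * d)"
    by (intro sum.cong) (auto simp: algebra_simps)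
  also have "\<dots> = a * c * of_bool (p = q) + a * d + b * c + n * (b * d)"
    using assms by (simp add: sum.distrib)
  finally show ?thesis .
qed

text \<open>The span is closed under products because J J = g J in the first tensor factor and J J =
  h J in the second. The entrywise sum is evaluated by applying the one-factor rule once for each
  factor.\<close>

lemma two_way_mat_mult:
  "two_way_mat g h a b c d * two_way_mat g h a' b' c' d' =
    two_way_mat g h (a * a')
      (a * b' + b * a' + g * b * b')
      (a * c' + c * a' + h * c * c')
      (a * d' + d * a' + b * c' + c * b'
        + g * (b * d' + d * b') + h * (c * d' + d * c') + g * h * d * d')"
    (is "?A * ?B = ?C")
proof (rule eq_matI)
  fix p q assume "p < dim_row ?C" and "q < dim_col ?C"
  then have pq: "p < g * h" "q < g * h"
    by (simp_all add: two_way_mat_def)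
  note ij = pq[THEN div_mod_less_of_less_mult(1)] pq[THEN div_mod_less_of_less_mult(2)]
  define F where "F i j =
    (a * (of_bool (p div h = i) * of_bool (p mod h = j))
     + b * of_bool (p mod h = j) + c * of_bool (p div h = i) + d) *
    (a' * (of_bool (i = q div h) * of_bool (j = q mod h))
     + b' * of_bool (j = q mod h) + c' * of_bool (i = q div h) + d')" for i j
  have "(?A * ?B) $$ (p, q) = (\<Sum>r = 0..<g * h. F (r div h) (r mod h))"
    using pq by (simp add: two_way_mat_def scalar_prod_def F_def)
  also have "\<dots> = (\<Sum>i = 0..<g. \<Sum>j = 0..<h. F i j)"
    by (rule sum_nat_div_mod)
  also have "\<dots> = ?C $$ (p, q)"
  proof -
    \<comment> \<open>For fixed \<open>i\<close>, each factor of \<open>F\<close> is affine in an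
      indicator on \<open>j\<close>, with coefficients that are themselves affine in an indicator on
      \<open>i\<close>. Hence the sum over \<open>j\<close> again consists of products to which the
      same rule applies in \<open>i\<close>.\<close>
    have "(\<Sum>j = 0..<h. F i j) =
        (a * of_bool (p div h = i) + b) * (a' * of_bool (i = q div h) + b')
          * of_bool (p mod h = q mod h)
        + (a * of_bool (p div h = i) + b) * (c' * of_bool (i = q div h) + d')
        + (c * of_bool (p div h = i) + d) * (a' * of_bool (i = q div h) + b')
        + h * ((c * of_bool (p div h = i) + d) * (c' * of_bool (i = q div h) + d'))" for i
      using sum_affine_of_bool[OF ij(3,4), of "a * of_bool (p div h = i) + b"
          "c * of_bool (p div h = i) + d" "a' * of_bool (i = q div h) + b'"
          "c' * of_bool (i = q div h) + d'"]
      by (simp add: F_def algebra_simps)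
    then have "(\<Sum>i = 0..<g. \<Sum>j = 0..<h. F i j) =
        (a * a' * of_bool (p div h = q div h) + a * b' + b * a' + g * (b * b'))
          * of_bool (p mod h = q mod h)
        + (a * c' * of_bool (p div h = q div h) + a * d' + b * c' + g * (b * d'))
        + (c * a' * of_bool (p div h = q div h) + c * b' + d * a' + g * (d * b'))
        + h * (c * c' * of_bool (p div h = q div h) + c * d' + d * c' + g * (d * d'))"
      by (simp only: sum.distrib sum_affine_of_bool[OF ij(1,2)]
          flip: sum_distrib_left sum_distrib_right)
    then show ?thesis
      using pq by (simp add: two_way_mat_def algebra_simps)
  qed
  finally show "(?A * ?B) $$ (p, q) = ?C $$ (p, q)" .
qed (simp_all add: two_way_mat_def)

text \<open>Separates the cell sizes from the two-way structure, which enters only through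
  \<open>XY\<close>. Outside the identity part, entry (p, q) of the product is entry (c p, c q) of
  the left side of \<open>XY\<close>, divided by the size of the cell of q.\<close>

lemma cell_model_inverse:
  fixes X Y :: "real mat" and ss :: "nat list" and s M :: real
  defines "N \<equiv> length ss"
  assumes X: "X \<in> carrier_mat N N" and Y: "Y \<in> carrier_mat N N"
    and pos: "\<And>k. k \<in> set ss \<Longrightarrow> k > 0" and "s \<noteq> 0" and "M \<noteq> 0"
    and XY: "s \<cdot>\<^sub>m Y + (M / s) \<cdot>\<^sub>m X + M \<cdot>\<^sub>m (X * Y) = 0\<^sub>m N N"
  defines "n \<equiv> sum_list ss" and "c \<equiv> seg_of ss"
  shows "mat n n (\<lambda>(p, q). (if p = q then s / M * real (ss ! c p) else 0) + X $$ (c p, c q)) *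
    mat n n (\<lambda>(p, q). (if p = q then M / s / real (ss ! c p) else 0)
      + M * Y $$ (c p, c q) / (real (ss ! c p) * real (ss ! c q))) = 1\<^sub>m n"
    (is "?V * ?W = _")
proof (rule eq_matI)
  fix p q assume "p < dim_row (1\<^sub>m n :: real mat)" and "q < dim_col (1\<^sub>m n :: real mat)"
  then have pq: "p < n" "q < n" by simp_all
  have cN: "c r < N" if "r < n" for r
    using that seg_of_bounds(1)[of r ss] by (simp add: c_def n_def N_def)
  have sz: "ss ! k \<noteq> 0" if "k < N" for k
    using that pos[of "ss ! k"] by (simp add: N_def)
  define x y where "x k l = X $$ (k, l)" and "y k l = Y $$ (k, l)" for k l
  define w where "w k = real (ss ! k)" for k
  have w: "w (c p) \<noteq> 0" "w (c q) \<noteq> 0"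
    using sz cN pq by (simp_all add: w_def)
  have zero: "s * y (c p) (c q) + M / s * x (c p) (c q)
      + M * (\<Sum>k = 0..<N. x (c p) k * y k (c q)) = 0"
    using arg_cong[OF XY, of "\<lambda>A. A $$ (c p, c q)"] cN[OF pq(1)] cN[OF pq(2)] X Y
    by (simp add: scalar_prod_def x_def y_def)
  have "(?V * ?W) $$ (p, q) = (\<Sum>r = 0..<n.
      ((if p = r then s / M * w (c p) else 0) + x (c p) (c r)) *
      ((if r = q then M / s / w (c r) else 0) + M * y (c r) (c q) / (w (c r) * w (c q))))"
    unfolding w_def using pq by (simp add: scalar_prod_def x_def y_def)
  \<comment> \<open>At \<open>r = p\<close> the diagonal part of the first factor meets both parts
    of the second, the two diagonal parts giving 1 if \<open>p = q\<close>. At \<open>r = q\<close>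
    the cell part of the first factor meets the diagonal part of the second; the last summand is the
    product of the two cell parts.\<close>
  also have "\<dots> = (\<Sum>r = 0..<n.
      (if r = p then (if p = q then 1 else 0) + s * y (c p) (c q) / w (c q) else 0)
      + (if r = q then x (c p) (c q) * (M / s) / w (c q) else 0)
      + x (c p) (c r) * M * y (c r) (c q) / (w (c r) * w (c q)))"
    using w \<open>s \<noteq> 0\<close> \<open>M \<noteq> 0\<close> by (intro sum.cong) (auto simp: field_simps)
  also have "\<dots> = (if p = q then 1 else 0) + s * y (c p) (c q) / w (c q)
      + x (c p) (c q) * (M / s) / w (c q)
      + (\<Sum>r = 0..<n. x (c p) (c r) * M * y (c r) (c q) / (w (c r) * w (c q)))"
    using pq by (simp add: sum.distrib)
  \<comment> \<open>The summand depends on \<open>r\<close> only through its cell. The resulting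
    weight \<open>w k\<close> then cancels against the \<open>w k\<close> in the
    denominator.\<close>
  also have "(\<Sum>r = 0..<n. x (c p) (c r) * M * y (c r) (c q) / (w (c r) * w (c q))) =
      (\<Sum>k = 0..<N. w k * (x (c p) k * M * y k (c q) / (w k * w (c q))))"
    unfolding n_def N_def c_def w_def by (rule sum_seg_of)
  also have "\<dots> = M * (\<Sum>k = 0..<N. x (c p) k * y k (c q)) / w (c q)"
    unfolding sum_distrib_left sum_divide_distrib
    using sz by (intro sum.cong[OF refl]) (simp add: w_def, force)
  also have "(if p = q then 1 else 0) + s * y (c p) (c q) / w (c q)
      + x (c p) (c q) * (M / s) / w (c q) + \<dots> =
      (if p = q then 1 else 0) + (s * y (c p) (c q) + M / s * x (c p) (c q)
      + M * (\<Sum>k = 0..<N. x (c p) k * y k (c q))) / w (c q)"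
    by (simp add: add_divide_distrib mult.commute)
  also have "\<dots> = 1\<^sub>m n $$ (p, q)"
    unfolding zero using pq by simp
  finally show "(?V * ?W) $$ (p, q) = 1\<^sub>m n $$ (p, q)" .
qed (simp_all add: n_def)

section \<open>Entry formulas for \<open>V_check\<close> and \<open>W\<close>, and the four
  coefficient identities\<close>

theorem corollary2:
  fixes g h :: nat and m :: "nat \<Rightarrow> nat \<Rightarrow> nat"
    and ve va vb vc lam0 lam1 lam3 lam5 lam7 mU :: real
    and \<delta> :: "nat \<Rightarrow> nat \<Rightarrow> real"
    and W :: "real mat"
  assumes "g \<ge> 1" and "h \<ge> 1"
    and "\<And>i j. i \<in> {1..g} \<Longrightarrow> j \<in> {1..h} \<Longrightarrow> m i j \<ge> 1"
    and "ve > 0" and "va \<ge> 0" and "vb \<ge> 0" and "vc \<ge> 0"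
    and "mU = real (max_cell g h m)"
    and "lam0 = ve"
    and "lam1 = ve + mU * vc + real h * mU * va + real g * mU * vb"
    and "lam3 = ve + mU * vc + real h * mU * va"
    and "lam5 = ve + mU * vc + real g * mU * vb"
    and "lam7 = ve + mU * vc"
    and "\<delta> 0 0 = 1 / lam7 - 1 / lam0"
    and "\<delta> 0 1 = 1 / lam5 - 1 / lam7"
    and "\<delta> 1 0 = 1 / lam3 - 1 / lam7"
    and "\<delta> 1 1 = 1 / lam1 - 1 / lam3 - 1 / lam5 + 1 / lam7"
    and "W = (mU / lam0) \<cdot>\<^sub>m I_m_bar g h m
           + mU \<cdot>\<^sub>m (cellwise
               (\<Oplus>\<^bsub>module_mat TYPE(real) (g * h) (g * h)\<^esub>i \<in> {0, 1} \<times> {0, 1}.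
                  case i of (i1, i2) \<Rightarrow>
                    \<delta> i2 i1 \<cdot>\<^sub>m ((avg_mat g ^\<^sub>m i1) \<otimes>\<^sub>K (avg_mat h ^\<^sub>m i2)))
             \<circledast> by_cells g h m (J_m_bar g h m))"
  shows "invertible_mat (V_check g h m ve va vb vc)
       \<and> inverts_mat (V_check g h m ve va vb vc) W
       \<and> inverts_mat W (V_check g h m ve va vb vc)"
proof -
  define ss where "ss = cell_sizes g h m"
  define c where "c = seg_of ss"
  have carr: "length ss = g * h"
    by (simp add: ss_def length_cell_sizes)
  have n: "num_obs g h m = sum_list ss"
    by (simp add: ss_def sum_list_cell_sizes)
  have cN: "c p < g * h" if "p < sum_list ss" for p
    using seg_of_bounds(1)[OF that] by (simp add: carr c_def)
  have mU: "mU > 0"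
    using max_cell_pos[OF assms(1-3)] assms(8) by simp
  \<comment> \<open>\<open>va\<close> goes with I (x) J and \<open>vb\<close> with J (x) I, hence
    the order \<open>vc\<close>, \<open>vb\<close>, \<open>va\<close>. In \<open>Y\<close> the
    averaging matrices contribute the factors 1 / g and 1 / h; the first index of
    \<open>\<delta>\<close> is the exponent of the second Kronecker factor.\<close>
  define X where "X = two_way_mat g h vc vb va 0"
  define Y where "Y = two_way_mat g h (\<delta> 0 0) (\<delta> 0 1 / g) (\<delta> 1 0 / h) (\<delta> 1 1 / (g * h))"
  have J: "J_m g h m = mat (sum_list ss) (sum_list ss) (\<lambda>_. 1)"
    by (simp add: J_m_def ones_mat_def n)
  have V: "V_check g h m ve va vb vc = mat (sum_list ss) (sum_list ss)
      (\<lambda>(p, q). (if p = q then ve / mU * real (ss ! c p) else 0) + X $$ (c p, c q))"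
    by (rule eq_matI)
      (auto simp: V_check_def D_mat_def I_m_M_def diag_block_mat_scalar_blocks by_cells_def
        one_kronecker_ones ones_kronecker_one one_kronecker_one cellwise_khatri_rao J
        cN carr X_def two_way_mat_def assms(8) simp flip: ss_def c_def)
  have S: "(\<Oplus>\<^bsub>module_mat TYPE(real) (g * h) (g * h)\<^esub>i \<in> {0, 1} \<times> {0, 1}.
      case i of (i1, i2) \<Rightarrow> \<delta> i2 i1 \<cdot>\<^sub>m ((avg_mat g ^\<^sub>m i1) \<otimes>\<^sub>K (avg_mat h ^\<^sub>m i2))) = Y"
  proof -
    interpret abelian_group "module_mat TYPE(real) (g * h) (g * h)"
      by (rule abelian_group_mat)
    let ?F = "\<lambda>i. case i of (i1, i2) \<Rightarrow>
      \<delta> i2 i1 \<cdot>\<^sub>m ((avg_mat g ^\<^sub>m i1) \<otimes>\<^sub>K (avg_mat h ^\<^sub>m i2))"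
    have pow: "avg_mat k ^\<^sub>m 0 = 1\<^sub>m k" "avg_mat k ^\<^sub>m 1 = avg_mat k" for k
      using left_mult_one_mat[of "avg_mat k" k k] by (simp_all add: avg_mat_def ones_mat_def)
    have F: "?F (0, 0) = two_way_mat g h (\<delta> 0 0) 0 0 0"
      "?F (0, 1) = two_way_mat g h 0 0 (\<delta> 1 0 / h) 0"
      "?F (1, 0) = two_way_mat g h 0 (\<delta> 0 1 / g) 0 0"
      "?F (1, 1) = two_way_mat g h 0 0 0 (\<delta> 1 1 / (g * h))"
      unfolding prod.case pow one_kronecker_one one_kronecker_avg avg_kronecker_one
        avg_kronecker_avg two_way_mat_smult
      by simp_all
    have ix: "{0, 1} \<times> {0, 1} = {(0, 0), (0, 1), (1, 0), (1, 1 :: nat)}" by auto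
    \<comment> \<open>Splitting \<open>finsum\<close> term by term requires each term to lie in the
      carrier; \<open>F\<close> shows this by identifying the terms as \<open>two_way_mat\<close>
      matrices.\<close>
    have "finsum (module_mat TYPE(real) (g * h) (g * h)) ?F {(0, 0), (0, 1), (1, 0), (1, 1)} =
        ?F (0, 0) + (?F (0, 1) + (?F (1, 0) + ?F (1, 1)))"
      using F by (simp add: module_mat_simps)
    then show ?thesis
      unfolding ix F two_way_mat_add Y_def by simp
  qed
  have W: "W = mat (sum_list ss) (sum_list ss)
      (\<lambda>(p, q). (if p = q then mU / ve / real (ss ! c p) else 0)
        + mU * Y $$ (c p, c q) / (real (ss ! c p) * real (ss ! c q)))"
    unfolding assms(18) S
    by (rule eq_matI)
      (auto simp: I_m_bar_def diag_block_mat_scalar_blocks by_cells_def cellwise_khatri_rao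
        J_m_bar_eq carr Y_def two_way_mat_def assms(9) field_simps simp flip: ss_def c_def)
  have "V_check g h m ve va vb vc * W = 1\<^sub>m (sum_list ss)"
    unfolding V W c_def
  proof (rule cell_model_inverse)
    show "X \<in> carrier_mat (length ss) (length ss)" "Y \<in> carrier_mat (length ss) (length ss)"
      by (simp_all add: X_def Y_def carr)
    show "k > 0" if "k \<in> set ss" for k
      using cell_sizes_pos[OF assms(3)] that by (auto simp: ss_def)
    show "ve \<noteq> 0" "mU \<noteq> 0"
      using assms(4) mU by simp_all
    \<comment> \<open>Each is \<open>ve > 0\<close> plus nonnegative terms, so all reciprocals in
      \<open>\<delta>\<close> are genuine.\<close>
    have l7: "lam7 > 0" "lam5 > 0" "lam3 > 0" "lam1 > 0"
      using assms(4-7) mU unfolding assms(10-13) by (simp_all add: add_pos_nonneg)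
    have gh: "real g > 0" "real h > 0"
      using assms(1,2) by simp_all
    \<comment> \<open>These relations eliminate the variance components other than
      \<open>ve\<close>, leaving rational identities in \<open>ve\<close> and the lambdas.\<close>
    have vc: "mU * vc = lam7 - ve" and va: "mU * va = (lam3 - lam7) / h"
      and vb: "mU * vb = (lam5 - lam7) / g" and l1: "lam1 = lam3 + lam5 - lam7"
      using gh by (simp_all add: assms(10-13))
    have ve: "ve \<noteq> 0"
      using assms(4) by simp
    \<comment> \<open>Coefficient of I (x) I.\<close>
    have "ve * \<delta> 0 0 + mU / ve * vc + mU * (vc * \<delta> 0 0) = 0"
    proof -
      have "ve * \<delta> 0 0 + mU / ve * vc + mU * (vc * \<delta> 0 0) =
          ve * \<delta> 0 0 + (mU * vc) / ve + (mU * vc) * \<delta> 0 0"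
        by (simp add: field_simps)
      also have "\<dots> = 0"
        using l7 ve unfolding vc assms(9,14) by (simp add: field_simps)
      finally show ?thesis .
    qed
    \<comment> \<open>Coefficient of J (x) I. After regrouping, the factor of
      \<open>\<delta> 0 1 / g\<close> is \<open>lam5\<close>, and
      \<open>1 / ve + \<delta> 0 0\<close> is \<open>1 / lam7\<close>.\<close>
    moreover have "ve * (\<delta> 0 1 / g) + mU / ve * vb
        + mU * (vc * (\<delta> 0 1 / g) + vb * \<delta> 0 0 + g * vb * (\<delta> 0 1 / g)) = 0"
    proof -
      have "ve * (\<delta> 0 1 / g) + mU / ve * vb
          + mU * (vc * (\<delta> 0 1 / g) + vb * \<delta> 0 0 + g * vb * (\<delta> 0 1 / g)) =
          (ve + mU * vc + g * (mU * vb)) * (\<delta> 0 1 / g) + (mU * vb) * (1 / ve + \<delta> 0 0)"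
        by (simp add: field_simps)
      also have "\<dots> = 0"
        using l7 ve gh unfolding vc vb assms(9,14,15) by (simp add: field_simps)
      finally show ?thesis .
    qed
    \<comment> \<open>Coefficient of I (x) J, the mirror image with \<open>lam3\<close> in place of
      \<open>lam5\<close>.\<close>
    moreover have "ve * (\<delta> 1 0 / h) + mU / ve * va
        + mU * (vc * (\<delta> 1 0 / h) + va * \<delta> 0 0 + h * va * (\<delta> 1 0 / h)) = 0"
    proof -
      have "ve * (\<delta> 1 0 / h) + mU / ve * va
          + mU * (vc * (\<delta> 1 0 / h) + va * \<delta> 0 0 + h * va * (\<delta> 1 0 / h)) =
          (ve + mU * vc + h * (mU * va)) * (\<delta> 1 0 / h) + (mU * va) * (1 / ve + \<delta> 0 0)"
        by (simp add: field_simps)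
      also have "\<dots> = 0"
        using l7 ve gh unfolding vc va assms(9,14,16) by (simp add: field_simps)
      finally show ?thesis .
    qed
    \<comment> \<open>Coefficient of J (x) J. \<open>X\<close> has none of its own, so there is no
      term with \<open>mU / ve\<close>.\<close>
    moreover have "ve * (\<delta> 1 1 / (g * h))
        + mU * (vc * (\<delta> 1 1 / (g * h)) + vb * (\<delta> 1 0 / h) + va * (\<delta> 0 1 / g)
          + g * (vb * (\<delta> 1 1 / (g * h))) + h * (va * (\<delta> 1 1 / (g * h)))) = 0"
    proof -
      have "ve * (\<delta> 1 1 / (g * h))
          + mU * (vc * (\<delta> 1 1 / (g * h)) + vb * (\<delta> 1 0 / h) + va * (\<delta> 0 1 / g)
            + g * (vb * (\<delta> 1 1 / (g * h))) + h * (va * (\<delta> 1 1 / (g * h)))) =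
          (ve + mU * vc + g * (mU * vb) + h * (mU * va)) * (\<delta> 1 1 / (g * h))
          + (mU * vb) * (\<delta> 1 0 / h) + (mU * va) * (\<delta> 0 1 / g)"
        by (simp add: algebra_simps)
      also have "\<dots> = (lam1 * \<delta> 1 1 + (lam5 - lam7) * \<delta> 1 0 + (lam3 - lam7) * \<delta> 0 1) / (g * h)"
        using gh unfolding vc va vb l1 by (simp add: field_simps)
      \<comment> \<open>\<open>lam1\<close> cancels against its reciprocal in
        \<open>\<delta> 1 1\<close>; elsewhere it is replaced by \<open>lam3 + lam5 - lam7\<close>,
        so that the last identity involves only three lambdas.\<close>
      also have "lam1 * \<delta> 1 1 = 1 - (lam3 + lam5 - lam7) * (1 / lam3 + 1 / lam5 - 1 / lam7)"
        using l7 unfolding assms(17) l1[symmetric] by (simp add: field_simps)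
      also have "\<dots> + (lam5 - lam7) * \<delta> 1 0 + (lam3 - lam7) * \<delta> 0 1 = 0"
        using l7 unfolding assms(15,16) by (simp add: field_simps)
      finally show ?thesis by simp
    qed
    \<comment> \<open>Writing the zero matrix as a \<open>two_way_mat\<close> with zero coefficients
      reduces the claim to the four identities.\<close>
    ultimately show "ve \<cdot>\<^sub>m Y + (mU / ve) \<cdot>\<^sub>m X + mU \<cdot>\<^sub>m (X * Y) = 0\<^sub>m (length ss) (length ss)"
      by (simp add: X_def Y_def two_way_mat_mult two_way_mat_smult two_way_mat_add carr
          flip: two_way_mat_zero)
  qed
  moreover have "V_check g h m ve va vb vc \<in> carrier_mat (sum_list ss) (sum_list ss)"
    and "W \<in> carrier_mat (sum_list ss) (sum_list ss)"
    by (simp_all add: V W)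
  \<comment> \<open>Both matrices are square of the same size, so the right inverse is also a left
    inverse.\<close>
  ultimately show ?thesis
    using mat_mult_left_right_inverse[of "V_check g h m ve va vb vc" "sum_list ss" W]
    by (auto simp: invertible_mat_def inverts_mat_def)
qed

end
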